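(* Let $q$ be a prime power, $1\neq\sigma\in\mathrm{Aut}(\mathbb F_q)$ with fixed field $\mathbb F_s$, $V^*=\mathbb F_q^{n+1}$ (row vectors), $M\in M_{n+1}(q)$ invertible, and $W$ a subspace of $V^*$ with $\dim W=r$. Then the number of points $[\xi]\in\mathrm{PG}(W)$ such that $[\xi^\sigma]=[\xi M]$ is at most $\frac{s^r-1}{s-1}$.
   Context: $\xi^\sigma$ is $\xi$ with $\sigma$ applied to each coordinate; $[\xi^\sigma]=[\xi M]$ means $\xi M$ is a nonzero scalar multiple of $\xi^\sigma$. *)

theory Defs
  imports "HOL-Analysis.Analysis"
begin

definition field_automorphism :: "('a::field \<Rightarrow> 'a) \<Rightarrow> bool" where
  "field_automorphism \<sigma> \<longleftrightarrow>
     bij \<sigma> \<and> \<sigma> 1 = 1 \<and>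
     (\<forall>x y. \<sigma> (x + y) = \<sigma> x + \<sigma> y) \<and> (\<forall>x y. \<sigma> (x * y) = \<sigma> x * \<sigma> y)"

definition fixed_field :: "('a \<Rightarrow> 'a) \<Rightarrow> 'a set" where
  "fixed_field \<sigma> = {x. \<sigma> x = x}"

definition coord_map :: "('a \<Rightarrow> 'a) \<Rightarrow> 'a ^ 'n \<Rightarrow> 'a ^ 'n" where
  "coord_map \<sigma> \<xi> = (\<chi> i. \<sigma> (\<xi> $ i))"

text \<open>The projective point \<open>[\<xi>]\<close> is the line spanned by \<open>\<xi>\<close>; it is meaningful for
  \<open>\<xi> \<noteq> 0\<close> only.\<close>

definition proj_point :: "'a::field ^ 'n \<Rightarrow> ('a ^ 'n) set" where
  "proj_point \<xi> = vec.span {\<xi>}"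

definition PG :: "('a::field ^ 'n) set \<Rightarrow> ('a ^ 'n) set set" where
  "PG W = {proj_point \<xi> |\<xi>. \<xi> \<in> W \<and> \<xi> \<noteq> 0}"

text \<open>The relation \<open>[\<eta>] = [\<zeta>]\<close> on representatives: \<open>\<zeta>\<close> is a nonzero scalar multiple
  of \<open>\<eta>\<close>.\<close>

definition same_point :: "'a::field ^ 'n \<Rightarrow> 'a ^ 'n \<Rightarrow> bool" where
  "same_point \<eta> \<zeta> \<longleftrightarrow> (\<exists>c. c \<noteq> 0 \<and> \<zeta> = c *s \<eta>)"

end

theory Submission
  imports Defs
begin

text \<open>With \<open>\<tau> = \<sigma>\<inverse>\<close>, the map \<open>\<phi> \<xi> = (\<xi> M)\<^sup>\<tau>\<close> is \<open>\<tau>\<close>-semilinear and \<open>[\<xi>\<^sup>\<sigma>] = [\<xi> M]\<close> says that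
  \<open>\<xi>\<close> is an eigenvector of \<open>\<phi>\<close>. Take a basis of eigenvectors of the span of all eigenvectors
  in \<open>W\<close>. If the coordinate of an eigenvector at a basis vector \<open>b\<close> is normalised to \<open>1\<close>, then
  its eigenvalue is that of \<open>b\<close>, so every other coordinate \<open>a\<close> solves an equation
  \<open>\<tau> a * d = c * a\<close> with \<open>d \<noteq> 0\<close>; its nonzero solutions have ratios in the fixed field, so
  there are at most \<open>s\<close> of them. Counting the points by their last nonzero coordinate bounds
  their number by \<open>1 + s + \<dots> + s^(r - 1)\<close>.\<close>

section \<open>Field automorphisms, fixed fields and the twisted scalar equation\<close>

lemma field_automorphism_zero:
  assumes "field_automorphism \<sigma>"
  shows "\<sigma> 0 = 0"
proof -
  have "\<sigma> (0 + 0) = \<sigma> 0 + \<sigma> 0"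
    using assms unfolding field_automorphism_def by blast
  then show ?thesis by (simp only: add_0_right add_cancel_right_right)
qed

lemma field_automorphism_eq_0_iff:
  assumes "field_automorphism \<sigma>"
  shows "\<sigma> x = 0 \<longleftrightarrow> x = 0"
proof -
  have "inj \<sigma>"
    using assms by (simp add: field_automorphism_def bij_is_inj)
  then show ?thesis
    using field_automorphism_zero[OF assms] by (metis injD)
qed

lemma field_automorphism_inv:
  assumes "field_automorphism \<sigma>"
  shows "field_automorphism (inv \<sigma>)"
proof -
  have b: "bij \<sigma>" and one: "\<sigma> 1 = 1"
    and add: "\<And>x y. \<sigma> (x + y) = \<sigma> x + \<sigma> y" and mult: "\<And>x y. \<sigma> (x * y) = \<sigma> x * \<sigma> y"
    using assms unfolding field_automorphism_def by blast+
  have l: "inv \<sigma> (\<sigma> x) = x" and r: "\<sigma> (inv \<sigma> x) = x" for x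
    using b by (simp_all add: bij_is_inj bij_is_surj surj_f_inv_f)
  show ?thesis
    unfolding field_automorphism_def
  proof (intro conjI allI)
    show "bij (inv \<sigma>)" using b by (rule bij_imp_bij_inv)
    show "inv \<sigma> 1 = 1" using l[of 1] one by simp
    show "inv \<sigma> (x + y) = inv \<sigma> x + inv \<sigma> y" for x y
      using l[of "inv \<sigma> x + inv \<sigma> y"] by (simp add: add r)
    show "inv \<sigma> (x * y) = inv \<sigma> x * inv \<sigma> y" for x y
      using l[of "inv \<sigma> x * inv \<sigma> y"] by (simp add: mult r)
  qed
qed

lemma fixed_field_inv:
  assumes "bij \<sigma>"
  shows "fixed_field (inv \<sigma>) = fixed_field \<sigma>"
proof -
  have "inv \<sigma> x = x \<longleftrightarrow> \<sigma> x = x" for x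
    using bij_inv_eq_iff[OF assms, of x x] by auto
  then show ?thesis by (simp add: fixed_field_def)
qed

lemma card_fixed_field_ge_2:
  fixes \<sigma> :: "'a::{field, finite} \<Rightarrow> 'a"
  assumes "field_automorphism \<sigma>"
  shows "card (fixed_field \<sigma>) \<ge> 2"
proof -
  have "{0, 1} \<subseteq> fixed_field \<sigma>"
    using assms field_automorphism_zero[OF assms]
    by (auto simp: fixed_field_def field_automorphism_def)
  then have "card {0, 1 :: 'a} \<le> card (fixed_field \<sigma>)"
    by (intro card_mono) auto
  then show ?thesis by simp
qed

text \<open>Dividing by one fixed nonzero solution \<open>a0\<close> embeds the solution set into
  the fixed field: both \<open>c\<close> and \<open>d\<close> cancel from the quotient of two
  equations, where \<open>d \<noteq> 0\<close> keeps the cancelled factor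
  \<open>\<tau> a0 * d\<close> nonzero.\<close>

lemma card_twisted_solutions_le:
  fixes \<tau> :: "'a::{field, finite} \<Rightarrow> 'a"
  assumes \<tau>: "field_automorphism \<tau>" and d: "d \<noteq> 0"
  shows "card {a. \<tau> a * d = c * a} \<le> card (fixed_field \<tau>)"
proof (cases "\<exists>a. a \<noteq> 0 \<and> \<tau> a * d = c * a")
  case True
  then obtain a0 where a0: "a0 \<noteq> 0" "\<tau> a0 * d = c * a0" by blast
  have "\<tau> (a / a0) = a / a0" if a: "\<tau> a * d = c * a" for a
  proof -
    have "\<tau> a = \<tau> (a / a0) * \<tau> a0"
    proof -
      have "\<tau> (a / a0 * a0) = \<tau> (a / a0) * \<tau> a0"
        using \<tau> unfolding field_automorphism_def by blast
      then show ?thesis using a0(1) by simp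
    qed
    then have "\<tau> (a / a0) * (\<tau> a0 * d) = c * a"
      using a by (simp add: mult.assoc)
    also have "\<dots> = (a / a0) * (\<tau> a0 * d)"
      using a0 by simp
    finally show ?thesis
      using a0(1) d field_automorphism_eq_0_iff[OF \<tau>, of a0]
        mult_right_cancel[of "\<tau> a0 * d" "\<tau> (a / a0)" "a / a0"] by simp
  qed
  then have "(\<lambda>a. a / a0) ` {a. \<tau> a * d = c * a} \<subseteq> fixed_field \<tau>"
    by (auto simp: fixed_field_def)
  moreover have "inj_on (\<lambda>a. a / a0) {a. \<tau> a * d = c * a}"
    using a0(1) by (auto simp: inj_on_def)
  ultimately show ?thesis
    by (intro card_inj_on_le[where f = "\<lambda>a. a / a0"]) auto
next
  case False
  \<comment> \<open>Without a nonzero solution there is nothing to divide by, but a single solution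
    is within the bound.\<close>
  then have "{a. \<tau> a * d = c * a} \<subseteq> {0}" by blast
  then have "card {a. \<tau> a * d = c * a} \<le> card {0 :: 'a}"
    by (intro card_mono) auto
  then show ?thesis
    using card_fixed_field_ge_2[OF \<tau>] by simp
qed

section \<open>Eigenvectors of a semilinear map\<close>

locale semilinear_endomorphism =
  fixes \<tau> :: "'a::{field, finite} \<Rightarrow> 'a" and \<phi> :: "'a ^ 'n \<Rightarrow> 'a ^ 'n"
  assumes automorphism: "field_automorphism \<tau>"
    and map_add: "\<phi> (x + y) = \<phi> x + \<phi> y"
    and map_scale: "\<phi> (a *s x) = \<tau> a *s \<phi> x"
begin

text \<open>The eigenvalue is required to be nonzero, like the scalar in \<open>same_point\<close>;
  this supplies the hypothesis \<open>d \<noteq> 0\<close> of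
  \<open>card_twisted_solutions_le\<close>.\<close>

definition eigenvector :: "'a ^ 'n \<Rightarrow> bool" where
  "eigenvector x \<longleftrightarrow> x \<noteq> 0 \<and> (\<exists>d. d \<noteq> 0 \<and> \<phi> x = d *s x)"

lemma map_zero: "\<phi> 0 = 0"
  using map_add[of 0 0] by simp

lemma map_span_eigenvectors:
  assumes "\<forall>b\<in>B. eigenvector b" and "x \<in> vec.span B"
  shows "\<phi> x \<in> vec.span B"
proof -
  have "vec.subspace {x. \<phi> x \<in> vec.span B}"
    by (rule vec.subspaceI)
       (auto simp: map_zero map_add map_scale vec.span_zero vec.span_add vec.span_scale)
  moreover have "B \<subseteq> {x. \<phi> x \<in> vec.span B}"
    using assms(1) by (auto simp: eigenvector_def vec.span_base vec.span_scale)
  ultimately show ?thesis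
    using assms(2) vec.span_minimal by blast
qed

text \<open>Scaling by \<open>a\<close> twists the eigenvalue \<open>d\<close> into
  \<open>\<tau> a * d / a\<close>. Being an eigenvector thus depends only on the projective point,
  while the eigenvalue depends on the representative.\<close>

lemma eigenvector_scale:
  assumes "eigenvector x" and "a \<noteq> 0"
  shows "eigenvector (a *s x)"
proof -
  obtain d where x: "x \<noteq> 0" and d: "d \<noteq> 0" "\<phi> x = d *s x"
    using assms(1) unfolding eigenvector_def by blast
  have "\<phi> (a *s x) = (\<tau> a * d / a) *s (a *s x)"
    using assms(2) d by (simp add: map_scale)
  moreover have "\<tau> a * d / a \<noteq> 0"
    using assms(2) d field_automorphism_eq_0_iff[OF automorphism] by simp
  ultimately show ?thesis
    using x assms(2) vec.scale_eq_0_iff[of a x] unfolding eigenvector_def by blast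
qed

text \<open>Modulo \<open>vec.span B\<close>, which \<open>\<phi>\<close> preserves, the eigenvector
  equation reads \<open>(\<tau> a * d - c * a) *s b = 0\<close>. As \<open>b\<close> lies outside
  the span, the coefficient vanishes, and what remains is the equation for \<open>y\<close>.\<close>

lemma eigenvector_coordinate:
  assumes B: "\<forall>x\<in>B. eigenvector x" and b: "b \<notin> vec.span B" "\<phi> b = d *s b"
    and y: "y \<in> vec.span B" and eigen: "\<phi> (a *s b + y) = c *s (a *s b + y)"
  shows "\<tau> a * d = c * a" and "\<phi> y = c *s y"
proof -
  have "(\<tau> a * d - c * a) *s b = c *s y - \<phi> y"
    using eigen b(2)
    by (simp add: map_add map_scale vec.scale_right_distrib vec.scale_left_diff_distrib
        algebra_simps)
  moreover have "c *s y - \<phi> y \<in> vec.span B"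
    using map_span_eigenvectors[OF B y] y by (simp add: vec.span_diff vec.span_scale)
  ultimately have *: "(\<tau> a * d - c * a) *s b \<in> vec.span B" by simp
  show eq: "\<tau> a * d = c * a"
  proof (rule ccontr)
    assume "\<tau> a * d \<noteq> c * a"
    then have "inverse (\<tau> a * d - c * a) * (\<tau> a * d - c * a) = 1"
      by (intro left_inverse) simp
    then show False
      using vec.span_scale[OF *, of "inverse (\<tau> a * d - c * a)"] b(1)
      unfolding vec.scale_scale by simp
  qed
  show "\<phi> y = c *s y"
    using \<open>(\<tau> a * d - c * a) *s b = c *s y - \<phi> y\<close> eq by simp
qed

text \<open>For fixed \<open>c\<close> the set is closed under addition and under scalars from the
  fixed field, hence a power of its size as bound. Each new basis vector contributes one coordinate
  with at most that many values, while the rest \<open>y\<close> solves the same equation in the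
  smaller span. The zero vector is counted too.\<close>

lemma card_eigenspace_le:
  assumes "finite B" and "vec.independent B" and "\<forall>b\<in>B. eigenvector b"
  shows "card {x \<in> vec.span B. \<phi> x = c *s x} \<le> card (fixed_field \<tau>) ^ card B"
  using assms
proof (induction B rule: finite_induct)
  case empty
  have "card {x \<in> vec.span {}. \<phi> x = c *s x} \<le> card {0 :: 'a ^ 'n}"
    by (intro card_mono) auto
  then show ?case by simp
next
  case (insert b B)
  have ind: "vec.independent B" and b: "b \<notin> vec.span B"
    using insert.prems(1) insert.hyps(2) unfolding vec.independent_insert by simp_all
  have B: "\<forall>x\<in>B. eigenvector x" using insert.prems(2) by blast
  obtain d where d: "d \<noteq> 0" "\<phi> b = d *s b"
    using insert.prems(2) unfolding eigenvector_def by blast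
  let ?A = "{a. \<tau> a * d = c * a}" and ?E = "{y \<in> vec.span B. \<phi> y = c *s y}"
  have "{x \<in> vec.span (insert b B). \<phi> x = c *s x} \<subseteq> (\<lambda>(a, y). a *s b + y) ` (?A \<times> ?E)"
  proof
    fix x assume "x \<in> {x \<in> vec.span (insert b B). \<phi> x = c *s x}"
    then obtain a where y: "x - a *s b \<in> vec.span B" and x: "\<phi> x = c *s x"
      unfolding vec.span_insert by blast
    have "\<phi> (a *s b + (x - a *s b)) = c *s (a *s b + (x - a *s b))"
      using x by simp
    note eigenvector_coordinate[OF B b d(2) y this]
    then have "(a, x - a *s b) \<in> ?A \<times> ?E" using y by blast
    then show "x \<in> (\<lambda>(a, y). a *s b + y) ` (?A \<times> ?E)"
      by (rule rev_image_eqI) simp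
  qed
  then have "card {x \<in> vec.span (insert b B). \<phi> x = c *s x} \<le> card (?A \<times> ?E)"
    by (rule surj_card_le[OF finite])
  also have "\<dots> = card ?A * card ?E"
    by (rule card_cartesian_product)
  also have "\<dots> \<le> card (fixed_field \<tau>) * card (fixed_field \<tau>) ^ card B"
    using card_twisted_solutions_le[OF automorphism d(1)] insert.IH[OF ind B]
    by (rule mult_le_mono)
  finally show ?case
    using insert.hyps by simp
qed

text \<open>Adding \<open>b\<close> to the basis creates only points represented by some
  \<open>b + y\<close>, where \<open>y\<close> satisfies the eigenvector equation with the
  eigenvalue \<open>d\<close> of \<open>b\<close>; \<open>card_eigenspace_le\<close> bounds these by
  the next power.\<close>

lemma card_eigenpoints_span_le:
  assumes "finite B" and "vec.independent B" and "\<forall>b\<in>B. eigenvector b"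
  shows "card {proj_point x |x. x \<in> vec.span B \<and> eigenvector x}
    \<le> (\<Sum>i<card B. card (fixed_field \<tau>) ^ i)"
  using assms
proof (induction B rule: finite_induct)
  case empty
  have "{proj_point x |x. x \<in> vec.span {} \<and> eigenvector x} = {}"
    by (auto simp: eigenvector_def)
  then show ?case by simp
next
  case (insert b B)
  have ind: "vec.independent B" and b: "b \<notin> vec.span B"
    using insert.prems(1) insert.hyps(2) unfolding vec.independent_insert by simp_all
  have B: "\<forall>x\<in>B. eigenvector x" using insert.prems(2) by blast
  obtain d where d: "d \<noteq> 0" "\<phi> b = d *s b"
    using insert.prems(2) unfolding eigenvector_def by blast
  let ?P = "{proj_point x |x. x \<in> vec.span B \<and> eigenvector x}"
  let ?E = "{y \<in> vec.span B. \<phi> y = d *s y}"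
  have "{proj_point x |x. x \<in> vec.span (insert b B) \<and> eigenvector x}
      \<subseteq> ?P \<union> (\<lambda>y. proj_point (b + y)) ` ?E"
  proof
    fix p assume "p \<in> {proj_point x |x. x \<in> vec.span (insert b B) \<and> eigenvector x}"
    then obtain x a where p: "p = proj_point x" and x: "eigenvector x"
      and a: "x - a *s b \<in> vec.span B"
      unfolding vec.span_insert by blast
    show "p \<in> ?P \<union> (\<lambda>y. proj_point (b + y)) ` ?E"
    proof (cases "a = 0")
      case True
      then show ?thesis using p x a by auto
    next
      case False
      define y where "y = inverse a *s (x - a *s b)"
      have y: "y \<in> vec.span B"
        unfolding y_def using a by (rule vec.span_scale)
      \<comment> \<open>The factor \<open>1\<close> is written out so that
        \<open>eigenvector_coordinate\<close> applies with \<open>a = 1\<close>; its equation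
        \<open>\<tau> 1 * d = c * 1\<close> then forces \<open>c = d\<close>.\<close>
      have x_eq: "inverse a *s x = 1 *s b + y"
        using False by (simp add: y_def vec.scale_right_diff_distrib)
      have "eigenvector (inverse a *s x)"
        using x False by (simp add: eigenvector_scale)
      then obtain c where "\<phi> (1 *s b + y) = c *s (1 *s b + y)"
        unfolding x_eq eigenvector_def by blast
      note eigenvector_coordinate[OF B b d(2) y this]
      then have "y \<in> ?E"
        using y automorphism by (auto simp: field_automorphism_def)
      moreover have "proj_point x = proj_point (b + y)"
        unfolding proj_point_def
        using False x_eq vec.span_image_scale[of "{x}" "\<lambda>_. inverse a"] by simp
      ultimately show ?thesis using p by blast
    qed
  qed
  then have "card {proj_point x |x. x \<in> vec.span (insert b B) \<and> eigenvector x}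
      \<le> card (?P \<union> (\<lambda>y. proj_point (b + y)) ` ?E)"
    by (intro card_mono) auto
  also have "\<dots> \<le> card ?P + card ((\<lambda>y. proj_point (b + y)) ` ?E)"
    by (rule card_Un_le)
  also have "\<dots> \<le> (\<Sum>i<card B. card (fixed_field \<tau>) ^ i) + card (fixed_field \<tau>) ^ card B"
    by (intro add_mono insert.IH[OF ind B] order_trans[OF card_image_le
          card_eigenspace_le[OF insert.hyps(1) ind B]]) simp
  finally show ?case
    using insert.hyps by simp
qed

text \<open>A maximal independent set of eigenvectors in \<open>W\<close> spans all of them. It may
  have fewer than \<open>vec.dim W\<close> elements, which only shortens the sum.\<close>

lemma card_eigenpoints_subspace_le:
  assumes "vec.subspace W"
  shows "card {proj_point x |x. x \<in> W \<and> eigenvector x}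
    \<le> (\<Sum>i<vec.dim W. card (fixed_field \<tau>) ^ i)"
proof -
  obtain B where B: "B \<subseteq> {x \<in> W. eigenvector x}" "vec.independent B"
      "{x \<in> W. eigenvector x} \<subseteq> vec.span B"
    using vec.maximal_independent_subset by blast
  have "card {proj_point x |x. x \<in> W \<and> eigenvector x}
      \<le> card {proj_point x |x. x \<in> vec.span B \<and> eigenvector x}"
    using B(3) by (intro card_mono) auto
  also have "\<dots> \<le> (\<Sum>i<card B. card (fixed_field \<tau>) ^ i)"
    using B by (intro card_eigenpoints_span_le) auto
  also have "\<dots> \<le> (\<Sum>i<vec.dim W. card (fixed_field \<tau>) ^ i)"
    using B vec.independent_card_le_dim[of B W] by (intro sum_mono2) auto
  finally show ?thesis .
qed

end

section \<open>From semilinear eigenvectors to the projective points\<close>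

theorem theorem3p9:
  fixes \<sigma> :: "'a::{field, finite} \<Rightarrow> 'a"
    and M :: "'a ^ 'n ^ 'n"
    and W :: "('a ^ 'n) set"
    and r s :: nat
  assumes "field_automorphism \<sigma>" and "\<sigma> \<noteq> id"
    and "s = card (fixed_field \<sigma>)"
    and "invertible M"
    and "vec.subspace W" and "vec.dim W = r"
  shows "real (card {proj_point \<xi> |\<xi>. \<xi> \<noteq> 0 \<and> proj_point \<xi> \<in> PG W \<and>
                       same_point (coord_map \<sigma> \<xi>) (\<xi> v* M)})
           \<le> (real s ^ r - 1) / (real s - 1)"
proof -
  define \<tau> where "\<tau> = inv \<sigma>"
  define \<phi> where "\<phi> \<xi> = coord_map \<tau> (\<xi> v* M)" for \<xi> :: "'a ^ 'n"
  have \<tau>: "field_automorphism \<tau>"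
    unfolding \<tau>_def using assms(1) by (rule field_automorphism_inv)
  then have \<tau>_add: "\<tau> (a + b) = \<tau> a + \<tau> b" and \<tau>_mult: "\<tau> (a * b) = \<tau> a * \<tau> b" for a b
    unfolding field_automorphism_def by blast+
  have \<sigma>: "bij \<sigma>"
    using assms(1) by (simp add: field_automorphism_def)
  interpret semilinear_endomorphism \<tau> \<phi>
  proof
    show "field_automorphism \<tau>" by (rule \<tau>)
    show "\<phi> (x + y) = \<phi> x + \<phi> y" for x y
      by (simp add: \<phi>_def coord_map_def vec_eq_iff vector_matrix_left_distrib \<tau>_add)
    show "\<phi> (a *s x) = \<tau> a *s \<phi> x" for a x
      by (simp add: \<phi>_def coord_map_def vec_eq_iff scalar_vector_matrix_assoc \<tau>_mult)
  qed
  \<comment> \<open>Membership in \<open>PG W\<close> gives only some representative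
    \<open>\<zeta>\<close> in \<open>W\<close>; the whole line, and with it \<open>\<xi>\<close>,
    lies in \<open>W\<close> because \<open>W\<close> is a subspace.\<close>
  have in_W: "\<xi> \<in> W" if \<xi>: "proj_point \<xi> \<in> PG W" for \<xi>
  proof -
    obtain \<zeta> where "proj_point \<xi> = proj_point \<zeta>" and "\<zeta> \<in> W"
      using \<xi> by (auto simp: PG_def)
    moreover have "\<xi> \<in> vec.span {\<xi>}"
      by (rule vec.span_base) simp
    moreover have "vec.span {\<zeta>} \<subseteq> W"
      using \<open>\<zeta> \<in> W\<close> assms(5) by (intro vec.span_minimal) simp_all
    ultimately show ?thesis
      unfolding proj_point_def by (metis subsetD)
  qed
  have eigen: "eigenvector \<xi>" if "\<xi> \<noteq> 0" and same: "same_point (coord_map \<sigma> \<xi>) (\<xi> v* M)" for \<xi>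
  proof -
    obtain c where c: "c \<noteq> 0" "\<xi> v* M = c *s coord_map \<sigma> \<xi>"
      using same unfolding same_point_def by blast
    have "\<tau> (\<sigma> x) = x" for x
      unfolding \<tau>_def using \<sigma> by (simp add: bij_is_inj)
    \<comment> \<open>Applying \<open>\<tau>\<close> to each coordinate undoes
      \<open>\<sigma>\<close> and turns the scalar \<open>c\<close> into the eigenvalue
      \<open>\<tau> c\<close>.\<close>
    then have "\<phi> \<xi> = \<tau> c *s \<xi>"
      unfolding \<phi>_def c(2) by (simp add: coord_map_def vec_eq_iff \<tau>_mult)
    moreover have "\<tau> c \<noteq> 0"
      using c(1) field_automorphism_eq_0_iff[OF \<tau>, of c] by simp
    ultimately show ?thesis
      using that(1) unfolding eigenvector_def by blast
  qed
  have s: "card (fixed_field \<tau>) = s"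
    unfolding \<tau>_def fixed_field_inv[OF \<sigma>] assms(3) ..
  \<comment> \<open>The fixed field contains 0 and 1, so the denominator \<open>real s - 1\<close>
    of the geometric sum is nonzero.\<close>
  have "s \<ge> 2"
    unfolding assms(3) using assms(1) by (rule card_fixed_field_ge_2)
  have "card {proj_point \<xi> |\<xi>. \<xi> \<noteq> 0 \<and> proj_point \<xi> \<in> PG W \<and>
      same_point (coord_map \<sigma> \<xi>) (\<xi> v* M)} \<le> card {proj_point \<xi> |\<xi>. \<xi> \<in> W \<and> eigenvector \<xi>}"
    using in_W eigen by (intro card_mono) auto
  also have "\<dots> \<le> (\<Sum>i<r. s ^ i)"
    using card_eigenpoints_subspace_le[OF assms(5)] assms(6) s by simp
  finally have "real (card {proj_point \<xi> |\<xi>. \<xi> \<noteq> 0 \<and> proj_point \<xi> \<in> PG W \<and>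
      same_point (coord_map \<sigma> \<xi>) (\<xi> v* M)}) \<le> real (\<Sum>i<r. s ^ i)"
    by (rule of_nat_mono)
  also have "\<dots> = (\<Sum>i<r. real s ^ i)" by simp
  also have "\<dots> = (real s ^ r - 1) / (real s - 1)"
    using \<open>s \<ge> 2\<close> by (intro geometric_sum) simp
  finally show ?thesis .
qed

end
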